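(* Let $\mathcal H$ be a real Hilbert space, let $M_1,\ldots,M_m$ be closed linear subspaces of $\mathcal H$, let $M:=\bigcap_{i=1}^m M_i$, $T:=P_{M_m}\cdots P_{M_1}$, and for $y_0\in\mathcal H$ put $y_k:=T^k(y_0)$, $k=1,2,\ldots$. Assume that $\sum_{i=1}^m M_i^\perp$ is not closed. Then there is a dense subset $U$ of $\mathcal H$ such that for each $y_0\in U$ and for all $\varepsilon>0$, $$\limsup_{k\to\infty}k^{1+\varepsilon}\|y_k-y_{k-1}\|=\infty\quad\text{and}\quad \limsup_{k\to\infty}k^{1/2+\varepsilon}\sqrt{\tfrac1m\sum_{i=1}^m d^2(y_k,M_i)}=\infty.$$ Moreover, there is a dense subset $V$ of $Y:=M\oplus\sum_{i=1}^m M_i^\perp$ such that for each $y_0\in V$ and for all $\varepsilon>0$, $$\limsup_{k\to\infty}k^{1/2+\varepsilon}\|y_k-P_M(y_0)\|=\infty,\qquad \limsup_{k\to\infty}k^{3/2+\varepsilon}\|y_k-y_{k-1}\|=\infty$$ and $$\limsup_{k\to\infty}k^{1+\varepsilon}\sqrt{\tfrac1m\sum_{i=1}^m d^2(y_k,M_i)}=\infty.$$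
   Context: For a closed linear subspace $L$ of $\mathcal H$, $P_L$ denotes the orthogonal projection onto $L$, $L^\perp$ the orthogonal complement, and $d(x,L)=\inf_{z\in L}\|x-z\|$. The sum $\sum_{i=1}^m M_i^\perp=\{x_1+\cdots+x_m: x_i\in M_i^\perp\}$ is algebraic (not closed up); it is orthogonal to $M$, and $M\oplus\sum_{i=1}^m M_i^\perp$ denotes the set of all $x_0+x$ with $x_0\in M$, $x\in\sum_{i=1}^m M_i^\perp$. Density is with respect to the norm topology. *)

theory Defs
  imports "HOL-Analysis.Analysis"
begin

(* The library's closest_point requires the sort heine_borel, that is, locally compact
   (finite-dimensional) spaces, so the orthogonal projection is defined here.
   For a closed subspace of a Hilbert space the described point exists and is unique. *)
definition orth_proj :: "'a::real_inner set \<Rightarrow> 'a \<Rightarrow> 'a" where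
  "orth_proj L x = (THE p. p \<in> L \<and> x - p \<in> L\<^sup>\<bottom>)"

(* proj_product M m = P_(M m) o ... o P_(M 1); the value M 0 is not used *)
primrec proj_product :: "(nat \<Rightarrow> 'a::real_inner set) \<Rightarrow> nat \<Rightarrow> 'a \<Rightarrow> 'a" where
  "proj_product M 0 = id"
| "proj_product M (Suc n) = orth_proj (M (Suc n)) \<circ> proj_product M n"

definition proj_iter :: "(nat \<Rightarrow> 'a::real_inner set) \<Rightarrow> nat \<Rightarrow> 'a \<Rightarrow> nat \<Rightarrow> 'a" where
  "proj_iter M m y\<^sub>0 k = (proj_product M m ^^ k) y\<^sub>0"

definition rms_dist :: "(nat \<Rightarrow> 'a::real_inner set) \<Rightarrow> nat \<Rightarrow> 'a \<Rightarrow> real" where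
  "rms_dist M m x = sqrt (1 / real m * (\<Sum>i=1..m. (infdist x (M i))\<^sup>2))"

end

theory Submission
  imports Defs
begin

text \<open>
  Write \<open>T\<close> for the product of the projections, \<open>P\<close> for the projection onto the intersection of
  the subspaces, and \<open>S\<close> for the algebraic sum of their orthogonal complements.

  All five divergence claims follow from slow decay of the error \<open>\<parallel>T\<^sup>k y - P y\<parallel>\<close> alone
  (\<open>limsup_infinite_of_slow_error\<close>). By the theorem of von Neumann and Halperin
  (\<open>iterate_tendsto\<close>) the error tends to zero, so a rate for its increments can be summed to a rate
  for the error itself, at the loss of one power of \<open>k\<close>. For the increments
  \<open>y\<^sub>k\<^sub>+\<^sub>1 - y\<^sub>k\<close> this is the triangle inequality. For the distances \<open>d(y\<^sub>k, M\<^sub>i)\<close> the squared error is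
  summed instead: \<open>\<parallel>y\<^sub>k\<parallel>\<^sup>2 - \<parallel>y\<^sub>k\<^sub>+\<^sub>1\<parallel>\<^sup>2\<close> is at most a constant times the largest squared distance,
  whence the loss is only half a power. It remains to find densely many starting points whose error
  is not \<open>O(k powr -(a + \<epsilon>))\<close> for any positive \<open>\<epsilon>\<close>, with \<open>a = 0\<close> in the whole space and
  \<open>a = 1/2\<close> in \<open>M \<oplus> S\<close>.

  Both are instances of one Baire category argument (\<open>closure_slower_than_eq_UNIV\<close>): if density fails,
  a single rate with a single constant holds on a nonempty open set, and by linearity it becomes a
  bound in operator norm. For \<open>a = 0\<close> this says that \<open>T\<^sup>k\<close> tends to \<open>P\<close> in operator norm. Then every
  \<open>z\<close> orthogonal to the intersection has the form \<open>w - T\<^sup>k w\<close>, which lies in \<open>S\<close>, so \<open>S\<close> is closed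
  (\<open>closed_perp_sum_if_contraction\<close>).

  For \<open>a = 1/2\<close>, the set \<open>M \<oplus> S\<close> is not complete in the norm, so the category argument is run in a
  complete space of which it is a continuous image: families of vectors, mapped to the sum of their
  projections (\<open>synth\<close>). A uniform rate then bounds \<open>T\<^sup>k\<close> on each complement by a multiple of
  \<open>k powr -(1/2 + \<epsilon>)\<close>. By duality this bounds the distances to the subspaces of the iterates of the
  adjoint, which is the product of the same projections in reverse order. The summation argument for
  distances, applied to the reversed product, gives its convergence in operator norm, and \<open>S\<close> is
  again closed (\<open>closed_perp_sum_if_rate_on_complements\<close>). In both cases this contradicts the assumption on \<open>S\<close>.
\<close>

section \<open>Orthogonal projections in Hilbert space\<close>

text \<open>
  By the parallelogram law a sequence of points of \<open>L\<close> whose distances to \<open>x\<close> tend to the infimum is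
  Cauchy. Its limit is a nearest point, and moving it along a direction of \<open>L\<close> cannot come closer
  to \<open>x\<close>, which is orthogonality.
\<close>

lemma orth_proj_exists:
  fixes L :: "'a::{real_inner, complete_space} set"
  assumes "subspace L" and "closed L"
  shows "\<exists>p\<in>L. x - p \<in> L\<^sup>\<bottom>"
proof -
  define d where "d = infdist x L"
  have L0: "L \<noteq> {}" using assms(1) subspace_0 by blast
  have d0: "0 \<le> d" by (simp add: d_def infdist_nonneg)
  have d_le: "d \<le> norm (x - z)" if "z \<in> L" for z
    using infdist_le[OF that, of x] by (simp add: d_def dist_norm)
  have "\<exists>z\<in>L. norm (x - z) < d + inverse (real (Suc n))" for n
  proof (rule ccontr)
    assume "\<not> ?thesis"
    then have "d + inverse (real (Suc n)) \<le> infdist x L"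
      unfolding infdist_notempty[OF L0] by (intro cINF_greatest[OF L0]) (force simp: dist_norm)
    then show False by (simp add: d_def)
  qed
  then obtain z where zL: "\<And>n. z n \<in> L"
    and zd: "\<And>n. norm (x - z n) < d + inverse (real (Suc n))"
    by metis
  have lim_d: "(\<lambda>n. norm (x - z n)) \<longlonglongrightarrow> d"
  proof (rule tendsto_sandwich[of "\<lambda>_. d" _ _ "\<lambda>n. d + inverse (real (Suc n))"])
    show "(\<lambda>n. d + inverse (real (Suc n))) \<longlonglongrightarrow> d"
      using tendsto_add[OF tendsto_const LIMSEQ_inverse_real_of_nat, of d] by simp
  qed (use d_le zL zd in \<open>auto intro!: always_eventually less_imp_le\<close>)
  \<comment> \<open>Parallelogram law; the midpoint of \<open>z i\<close> and \<open>z j\<close> is in \<open>L\<close>, so its distance from \<open>x\<close> is at least \<open>d\<close>.\<close>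
  have par: "(norm (z i - z j))\<^sup>2 \<le> 2 * ((norm (x - z i))\<^sup>2 - d\<^sup>2) + 2 * ((norm (x - z j))\<^sup>2 - d\<^sup>2)" for i j
  proof -
    have "(1/2) *\<^sub>R (z i + z j) \<in> L"
      using assms(1) zL by (simp add: subspace_add subspace_scale)
    then have "d \<le> norm (x - (1/2) *\<^sub>R (z i + z j))" by (rule d_le)
    then have "d\<^sup>2 \<le> (norm (x - (1/2) *\<^sub>R (z i + z j)))\<^sup>2" using d0 by (simp add: power_mono)
    then show ?thesis
      by (simp add: power2_norm_eq_inner inner_simps inner_commute algebra_simps)
  qed
  have "Cauchy z"
  proof (rule metric_CauchyI)
    fix e :: real assume "0 < e"
    have "(\<lambda>n. (norm (x - z n))\<^sup>2 - d\<^sup>2) \<longlonglongrightarrow> d\<^sup>2 - d\<^sup>2"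
      by (intro tendsto_intros lim_d)
    then have "\<forall>\<^sub>F n in sequentially. (norm (x - z n))\<^sup>2 - d\<^sup>2 < e\<^sup>2 / 4"
      using \<open>0 < e\<close> by (intro order_tendstoD(2)) auto
    then obtain N where N: "\<And>n. n \<ge> N \<Longrightarrow> (norm (x - z n))\<^sup>2 - d\<^sup>2 < e\<^sup>2 / 4"
      by (auto simp: eventually_sequentially)
    have "dist (z i) (z j) < e" if "i \<ge> N" "j \<ge> N" for i j
    proof -
      have "(norm (z i - z j))\<^sup>2 < e\<^sup>2" using par[of i j] N[OF that(1)] N[OF that(2)] by argo
      then show ?thesis using \<open>0 < e\<close> by (simp add: dist_norm power2_less_imp_less)
    qed
    then show "\<exists>M. \<forall>m\<ge>M. \<forall>n\<ge>M. dist (z m) (z n) < e" by blast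
  qed
  then obtain p where p: "z \<longlonglongrightarrow> p" using Cauchy_convergent convergent_def by blast
  have pL: "p \<in> L" using closed_sequentially[OF assms(2)] zL p by blast
  have "(\<lambda>n. norm (x - z n)) \<longlonglongrightarrow> norm (x - p)" by (intro tendsto_intros p)
  then have pd: "norm (x - p) = d" using lim_d LIMSEQ_unique by blast
  have "inner v (x - p) = 0" if v: "v \<in> L" for v
  proof (cases "v = 0")
    case False
    \<comment> \<open>The minimiser of \<open>\<parallel>x - (p + t v)\<parallel>\<close> over real \<open>t\<close>.\<close>
    define t where "t = inner v (x - p) / inner v v"
    have "p + t *\<^sub>R v \<in> L" using assms(1) pL v by (simp add: subspace_add subspace_scale)
    then have "(norm (x - p))\<^sup>2 \<le> (norm (x - (p + t *\<^sub>R v)))\<^sup>2"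
      using d_le d0 pd by (simp add: power_mono)
    also have "x - (p + t *\<^sub>R v) = (x - p) - t *\<^sub>R v" by simp
    also have "(norm \<dots>)\<^sup>2 = (norm (x - p))\<^sup>2 - 2 * t * inner v (x - p) + t * (t * inner v v)"
      by (simp add: power2_norm_eq_inner inner_diff_left inner_diff_right inner_commute)
    also have "t * inner v v = inner v (x - p)" using False by (simp add: t_def)
    finally have "t * inner v (x - p) \<le> 0" by simp
    then have "(inner v (x - p))\<^sup>2 / inner v v \<le> 0" by (simp add: t_def power2_eq_square)
    moreover have "0 < inner v v" using False by simp
    ultimately show ?thesis by (simp add: divide_le_0_iff)
  qed simp
  then show ?thesis using pL by (auto simp: orthogonal_comp_def orthogonal_def)
qed

lemma orthogonal_comp_inner: "\<lbrakk>v \<in> L; w \<in> L\<^sup>\<bottom>\<rbrakk> \<Longrightarrow> inner v w = 0"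
  by (simp add: orthogonal_comp_def orthogonal_def)

lemma closed_orthogonal_comp: "closed (L\<^sup>\<bottom>)" for L :: "'a::real_inner set"
proof -
  have "L\<^sup>\<bottom> = (\<Inter>v\<in>L. {w. inner v w = 0})"
    by (auto simp: orthogonal_comp_def orthogonal_def)
  also have "closed \<dots>" by (intro closed_INT ballI closed_Collect_eq continuous_intros)
  finally show ?thesis .
qed

locale closed_subspace =
  fixes L :: "'a::{real_inner, complete_space} set"
  assumes subspace: "subspace L" and closed: "closed L"
begin

lemma orth_proj_eqI:
  assumes "p \<in> L" and "x - p \<in> L\<^sup>\<bottom>"
  shows "orth_proj L x = p"
  unfolding orth_proj_def
proof (rule the_equality)
  fix q assume q: "q \<in> L \<and> x - q \<in> L\<^sup>\<bottom>"
  have "q - p \<in> L" using q assms subspace subspace_diff by blast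
  moreover have "(x - p) - (x - q) \<in> L\<^sup>\<bottom>"
    using q assms subspace_orthogonal_comp subspace_diff by blast
  ultimately have "inner (q - p) (q - p) = 0" using orthogonal_comp_inner[of "q - p" L "q - p"] by simp
  then show "q = p" by simp
qed (use assms in blast)

lemma orth_proj_mem: "orth_proj L x \<in> L"
  and orth_proj_residual: "x - orth_proj L x \<in> L\<^sup>\<bottom>"
  using orth_proj_exists[OF subspace closed, of x] orth_proj_eqI by auto

lemma orth_proj_of_mem: "x \<in> L \<Longrightarrow> orth_proj L x = x"
  by (rule orth_proj_eqI) (auto simp: subspace_0 subspace_orthogonal_comp)

lemma orth_proj_of_orthogonal: "x \<in> L\<^sup>\<bottom> \<Longrightarrow> orth_proj L x = 0"
  by (rule orth_proj_eqI) (auto simp: subspace_0 subspace)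

lemma linear_orth_proj: "linear (orth_proj L)"
proof (rule linearI)
  show "orth_proj L (x + y) = orth_proj L x + orth_proj L y" for x y
  proof (rule orth_proj_eqI)
    have "(x - orth_proj L x) + (y - orth_proj L y) \<in> L\<^sup>\<bottom>"
      by (intro subspace_add subspace_orthogonal_comp orth_proj_residual)
    then show "x + y - (orth_proj L x + orth_proj L y) \<in> L\<^sup>\<bottom>" by (simp add: algebra_simps)
  qed (intro subspace_add subspace orth_proj_mem)
  show "orth_proj L (c *\<^sub>R x) = c *\<^sub>R orth_proj L x" for c x
  proof (rule orth_proj_eqI)
    have "c *\<^sub>R (x - orth_proj L x) \<in> L\<^sup>\<bottom>"
      by (intro subspace_scale subspace_orthogonal_comp orth_proj_residual)
    then show "c *\<^sub>R x - c *\<^sub>R orth_proj L x \<in> L\<^sup>\<bottom>" by (simp add: algebra_simps)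
  qed (intro subspace_scale subspace orth_proj_mem)
qed

lemma inner_orth_proj_left: "inner (orth_proj L x) y = inner (orth_proj L x) (orth_proj L y)"
  using orthogonal_comp_inner[OF orth_proj_mem orth_proj_residual, of x y]
  by (simp add: inner_diff_right)

lemma orth_proj_self_adjoint: "inner (orth_proj L x) y = inner x (orth_proj L y)"
  using inner_orth_proj_left[of x y] inner_orth_proj_left[of y x] by (simp add: inner_commute)

lemma orth_proj_pythagoras: "(norm x)\<^sup>2 = (norm (orth_proj L x))\<^sup>2 + (norm (x - orth_proj L x))\<^sup>2"
  using orthogonal_comp_inner[OF orth_proj_mem orth_proj_residual, of x x]
  by (simp add: power2_norm_eq_inner inner_diff_left inner_diff_right inner_commute)

lemma norm_orth_proj_le: "norm (orth_proj L x) \<le> norm x"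
  by (rule power2_le_imp_le) (simp_all add: orth_proj_pythagoras[of x])

lemma norm_residual_le: "norm (x - orth_proj L x) \<le> norm x"
  by (rule power2_le_imp_le) (simp_all add: orth_proj_pythagoras[of x])

lemma infdist_eq_norm_residual: "infdist x L = norm (x - orth_proj L x)"
proof (rule antisym)
  show "infdist x L \<le> norm (x - orth_proj L x)"
    using infdist_le[OF orth_proj_mem, of x x] by (simp add: dist_norm)
  have "norm (x - orth_proj L x) \<le> dist x z" if z: "z \<in> L" for z
  proof -
    have "orth_proj L (x - z) = orth_proj L x - z"
      using linear_diff[OF linear_orth_proj] orth_proj_of_mem[OF z] by simp
    then have "(norm (x - orth_proj L x))\<^sup>2 \<le> (norm (x - z))\<^sup>2"
      using orth_proj_pythagoras[of "x - z"] by simp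
    then show ?thesis unfolding dist_norm by (rule power2_le_imp_le) simp
  qed
  then show "norm (x - orth_proj L x) \<le> infdist x L"
    using subspace subspace_0 by (force simp: infdist_def intro!: cINF_greatest)
qed

end

section \<open>Polynomial rates\<close>

text \<open>
  For nonnegative \<open>f\<close>, the negation of "\<open>f = O(k powr -(a + \<epsilon>))\<close> for some positive \<open>\<epsilon>\<close>". The bound that fails is one
  for all \<open>k \<ge> 1\<close>, not just for large \<open>k\<close>: \<open>C\<close> can absorb finitely many terms, and the condition becomes a
  countable intersection of open ones when \<open>f\<close> depends continuously on a parameter.
\<close>
definition slower_than :: "real \<Rightarrow> (nat \<Rightarrow> real) \<Rightarrow> bool" where
  "slower_than a f \<longleftrightarrow> (\<forall>\<epsilon>>0. \<forall>C. \<exists>k\<ge>1. C * real k powr - (a + \<epsilon>) < f k)"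

lemma powr_bound_if_limsup_finite:
  fixes f :: "nat \<Rightarrow> real"
  assumes "limsup (\<lambda>k. ereal (real k powr b * f k)) \<noteq> \<infinity>"
  shows "\<exists>C\<ge>0. \<forall>k\<ge>1. f k \<le> C * real k powr - b"
proof -
  obtain B where "limsup (\<lambda>k. ereal (real k powr b * f k)) < ereal B"
    using assms less_PInf_Ex_of_nat by force
  then have "\<forall>\<^sub>F k in sequentially. ereal (real k powr b * f k) < ereal B" by (rule Limsup_lessD)
  then obtain N where N: "\<And>k. k \<ge> N \<Longrightarrow> real k powr b * f k < B"
    by (auto simp: eventually_sequentially)
  define C where "C = \<bar>B\<bar> + (\<Sum>k<N. \<bar>real k powr b * f k\<bar>)"
  have C: "real k powr b * f k \<le> C" for k
  proof (cases "k < N")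
    case True
    then have "\<bar>real k powr b * f k\<bar> \<le> (\<Sum>k<N. \<bar>real k powr b * f k\<bar>)"
      by (intro member_le_sum) auto
    then show ?thesis by (simp add: C_def)
  next
    case False
    then have "real k powr b * f k \<le> \<bar>B\<bar>" using N[of k] by simp
    then show ?thesis by (simp add: C_def add_increasing2 sum_nonneg)
  qed
  have "f k \<le> C * real k powr - b" if "k \<ge> 1" for k
  proof -
    have "f k = (real k powr b * f k) * real k powr - b"
      using that by (simp add: powr_minus field_simps)
    also have "\<dots> \<le> C * real k powr - b" by (intro mult_right_mono C) auto
    finally show ?thesis .
  qed
  moreover have "C \<ge> 0" by (simp add: C_def sum_nonneg)
  ultimately show ?thesis by blast
qed

text \<open>
  By the mean value theorem, the difference on the right is \<open>s * z powr -(1 + s)\<close> for some \<open>z\<close> between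
  \<open>j\<close> and \<open>j + 1\<close>, and \<open>j + 1 \<le> 2 * j\<close>. This replaces an integral comparison for the tails of
  \<open>\<Sum>j. j powr -(1 + s)\<close>.
\<close>

lemma powr_le_telescoping:
  fixes s :: real
  assumes "s > 0" and "j \<ge> (1::nat)"
  shows "real j powr - (1 + s) \<le> 2 powr (1 + s) / s * (real j powr - s - real (Suc j) powr - s)"
proof -
  have "\<exists>z>real j. z < real (Suc j) \<and> real (Suc j) powr - s - real j powr - s
      = (real (Suc j) - real j) * (- s * z powr (- s - 1))"
    using assms by (intro MVT2) (auto intro!: derivative_eq_intros simp: powr_diff)
  then obtain z where z: "real j < z" "z < real (Suc j)"
    and "real (Suc j) powr - s - real j powr - s = (real (Suc j) - real j) * (- s * z powr (- s - 1))"
    by blast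
  moreover have "- s - 1 = - (1 + s)" "real (Suc j) - real j = 1" by simp_all
  ultimately have eq: "real j powr - s - real (Suc j) powr - s = s * z powr - (1 + s)" by simp
  have "(2 * real j) powr - (1 + s) \<le> z powr - (1 + s)"
    using assms z by (intro powr_mono2') auto
  then have "2 powr (1 + s) * (2 powr - (1 + s) * real j powr - (1 + s)) \<le> 2 powr (1 + s) * z powr - (1 + s)"
    by (intro mult_left_mono) (auto simp: powr_mult)
  also have "2 powr (1 + s) * (2 powr - (1 + s) * real j powr - (1 + s)) = real j powr - (1 + s)"
    by (simp add: powr_minus[of _ "1 + s"] del: minus_add_distrib)
  also have "2 powr (1 + s) * z powr - (1 + s) = 2 powr (1 + s) / s * (real j powr - s - real (Suc j) powr - s)"
    unfolding eq using assms by simp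
  finally show ?thesis .
qed

text \<open>
  Summing the bound on the decrements from \<open>k\<close> to infinity costs one power of \<open>k\<close>. The sum is avoided:
  the bound to be proved minus \<open>g\<close> is decreasing with limit zero, hence nonnegative. The constant is
  explicit since the rates are needed uniformly in the starting point.
\<close>

lemma null_sequence_powr_rate:
  fixes g :: "nat \<Rightarrow> real"
  assumes "s > 0" and "C \<ge> 0" and lim: "g \<longlonglongrightarrow> 0"
    and step: "\<And>k. k \<ge> 1 \<Longrightarrow> g k - g (Suc k) \<le> C * real k powr - (1 + s)"
    and "k \<ge> 1"
  shows "g k \<le> 2 powr (1 + s) / s * C * real k powr - s"
proof -
  define K where "K = 2 powr (1 + s) / s"
  define h where "h j = K * C * real j powr - s - g j" for j
  have "h (Suc j) \<le> h j" if "j \<ge> 1" for j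
  proof -
    have "g j - g (Suc j) \<le> C * (K * (real j powr - s - real (Suc j) powr - s))"
      unfolding K_def
      by (rule order.trans[OF step[OF that]]) (intro mult_left_mono powr_le_telescoping assms that)
    then show ?thesis by (simp add: h_def algebra_simps)
  qed
  then have "decseq (\<lambda>n. h (n + k))" using \<open>k \<ge> 1\<close> by (intro decseq_SucI) auto
  moreover have "(\<lambda>j. real j powr - s) \<longlonglongrightarrow> 0"
    using assms(1) by (intro tendsto_neg_powr filterlim_real_sequentially) auto
  then have "h \<longlonglongrightarrow> K * C * 0 - 0" unfolding h_def by (intro tendsto_intros lim)
  then have "(\<lambda>n. h (n + k)) \<longlonglongrightarrow> 0" using LIMSEQ_ignore_initial_segment by fastforce
  ultimately have "0 \<le> h (0 + k)" by (rule decseq_ge)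
  then show ?thesis by (simp add: h_def K_def)
qed

section \<open>Density by Baire category\<close>

text \<open>
  The parameters with slow decay contain the intersection of the open sets on which some term exceeds
  \<open>n * k powr -(a + 1/(n + 1))\<close>. The assumption implies that each of these sets is dense.
\<close>

lemma closure_slower_than_eq_UNIV:
  fixes D :: "nat \<Rightarrow> 'e::complete_space \<Rightarrow> 'b::real_normed_vector"
  assumes cont: "\<And>k. continuous_on UNIV (D k)"
    and unbounded: "\<And>S \<epsilon> C. \<lbrakk>open S; S \<noteq> {}; \<epsilon> > 0\<rbrakk> \<Longrightarrow>
      \<exists>e\<in>S. \<exists>k\<ge>1. C * real k powr - (a + \<epsilon>) < norm (D k e)"
  shows "closure {e. slower_than a (\<lambda>k. norm (D k e))} = UNIV"
proof -
  define G where "G n = (\<Union>k\<in>{1..}. {e. real n * real k powr - (a + 1 / real (Suc n)) < norm (D k e)})" for n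
  have "open (G n)" for n
    unfolding G_def by (intro open_UN ballI open_Collect_less continuous_intros cont)
  moreover have "closure (G n) = UNIV" for n
  proof -
    have "G n \<inter> S \<noteq> {}" if S: "open S" "S \<noteq> {}" for S
      using unbounded[OF S, of "1 / real (Suc n)" "real n"] by (auto simp: G_def)
    then show ?thesis by (fastforce simp: closure_iff_nhds_not_empty)
  qed
  moreover have "Met_TC.mcomplete TYPE('e)" by (simp add: complete_UNIV)
  ultimately have "closure (\<Inter>(range G)) = UNIV"
    using Met_TC.metric_Baire_category[of "range G"] by auto
  moreover have "slower_than a (\<lambda>k. norm (D k e))" if e: "\<And>n. e \<in> G n" for e
    unfolding slower_than_def
  proof (intro allI impI)
    fix \<epsilon> C :: real
    assume "\<epsilon> > 0"
    obtain n1 where n1: "1 / real (Suc n1) < \<epsilon>" using \<open>\<epsilon> > 0\<close> nat_approx_posE by blast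
    obtain n2 where n2: "C \<le> real n2" using real_arch_simple by blast
    define n where "n = max n1 n2"
    have n: "1 / real (Suc n) \<le> \<epsilon>" "C \<le> real n"
    proof -
      have "1 / real (Suc n) \<le> 1 / real (Suc n1)" by (intro divide_left_mono) (auto simp: n_def)
      then show "1 / real (Suc n) \<le> \<epsilon>" using n1 by linarith
    qed (use n2 in \<open>auto simp: n_def\<close>)
    obtain k :: nat where k: "k \<ge> 1" "real n * real k powr - (a + 1 / real (Suc n)) < norm (D k e)"
      using e by (auto simp: G_def)
    have "C * real k powr - (a + \<epsilon>) \<le> real n * real k powr - (a + 1 / real (Suc n))"
      using k n by (intro mult_mono powr_mono) auto
    then show "\<exists>k\<ge>1. C * real k powr - (a + \<epsilon>) < norm (D k e)"
      using k by (meson order.strict_trans1)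
  qed
  then have "\<Inter>(range G) \<subseteq> {e. slower_than a (\<lambda>k. norm (D k e))}" by auto
  then have "closure (\<Inter>(range G)) \<subseteq> closure {e. slower_than a (\<lambda>k. norm (D k e))}"
    by (rule closure_mono)
  ultimately show ?thesis by auto
qed

lemma linear_bound_of_local_bound:
  fixes f :: "'b::real_normed_vector \<Rightarrow> 'c::real_normed_vector"
  assumes "linear f" and "subspace W" and "\<delta> > 0"
    and local: "\<And>t. t \<in> W \<Longrightarrow> norm t < \<delta> \<Longrightarrow> norm (f t) \<le> B"
    and "t \<in> W"
  shows "norm (f t) \<le> 2 * B / \<delta> * norm t"
proof (cases "t = 0")
  case False
  define c where "c = \<delta> / (2 * norm t)"
  have c: "c > 0" using False \<open>\<delta> > 0\<close> by (simp add: c_def)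
  have "norm (f (c *\<^sub>R t)) \<le> B"
    using False \<open>\<delta> > 0\<close> by (intro local subspace_scale assms) (simp add: c_def)
  then have "norm (f t) \<le> B / c"
    using c by (simp add: linear_cmul[OF \<open>linear f\<close>] pos_le_divide_eq mult.commute)
  then show ?thesis by (simp add: c_def algebra_simps)
qed (simp add: linear_0[OF \<open>linear f\<close>])

lemma continuous_on_nonexpansive_linear:
  fixes f :: "'b::real_normed_vector \<Rightarrow> 'c::real_normed_vector"
  assumes "linear f" and "\<And>x. norm (f x) \<le> norm x"
  shows "continuous_on S f"
  by (rule linear_continuous_on, rule bounded_linear_intro[of _ 1])
    (use assms in \<open>auto simp: linear_add linear_cmul\<close>)

section \<open>Products of projections\<close>

lemma subspace_set_plus:
  assumes "subspace A" and "subspace B"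
  shows "subspace (A + B)"
proof -
  have "A + B = {x + y |x y. x \<in> A \<and> y \<in> B}" by (auto simp: set_plus_def)
  then show ?thesis using subspace_sums[OF assms] by simp
qed

lemma subspace_set_sum:
  "(\<And>i. i \<in> I \<Longrightarrow> subspace (S i)) \<Longrightarrow> subspace (\<Sum>i\<in>I. S i)"
  by (induction I rule: infinite_finite_induct)
     (auto simp: set_zero intro: subspace_set_plus subspace_single_0)

lemma subspace_closure:
  fixes S :: "'b::real_normed_vector set"
  assumes "subspace S"
  shows "subspace (closure S)"
  unfolding subspace_def
proof (intro conjI ballI allI)
  show "0 \<in> closure S" using subspace_0[OF assms] closure_subset by blast
  have "S + S \<subseteq> S" using assms by (auto simp: set_plus_def subspace_add)
  then have "closure S + closure S \<subseteq> closure S" by (meson closure_mono closure_sum order_trans)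
  then show "x + y \<in> closure S" if "x \<in> closure S" "y \<in> closure S" for x y
    using that by (blast intro: set_plus_intro)
  have "(*\<^sub>R) c ` S \<subseteq> S" for c using assms by (auto simp: subspace_scale)
  then show "c *\<^sub>R x \<in> closure S" if "x \<in> closure S" for c x
    using that closure_mono by (metis closure_scaleR image_eqI subsetD)
qed

lemma proj_product_Suc_right:
  "proj_product M (Suc n) x = proj_product (\<lambda>i. M (Suc i)) n (orth_proj (M 1) x)"
  by (induction n) simp_all

text \<open>
  Projections are self-adjoint, so the adjoint of their product is the product in reverse order.
\<close>

lemma inner_proj_product_reverse:
  assumes "\<And>i. i \<in> {1..n} \<Longrightarrow> closed_subspace (M i)"
  shows "inner (proj_product M n x) y = inner x (proj_product (\<lambda>i. M (Suc n - i)) n y)"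
  using assms
proof (induction n arbitrary: y)
  case (Suc n)
  have "inner (proj_product M (Suc n) x) y = inner (proj_product M n x) (orth_proj (M (Suc n)) y)"
    using closed_subspace.orth_proj_self_adjoint[of "M (Suc n)"] Suc.prems by simp
  also have "\<dots> = inner x (proj_product (\<lambda>i. M (Suc n - i)) n (orth_proj (M (Suc n)) y))"
    using Suc by simp
  also have "\<dots> = inner x (proj_product (\<lambda>i. M (Suc (Suc n) - i)) (Suc n) y)"
    by (simp only: proj_product_Suc_right diff_Suc_Suc diff_zero One_nat_def)
  finally show ?case .
qed simp

locale closed_subspace_family =
  fixes M :: "nat \<Rightarrow> 'a::{real_inner, complete_space} set" and m :: nat
  assumes closed_subspace: "i \<in> {1..m} \<Longrightarrow> closed_subspace (M i)"
begin

definition common :: "'a set" where "common = (\<Inter>i\<in>{1..m}. M i)"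

definition perp_sum :: "'a set" where "perp_sum = (\<Sum>i\<in>{1..m}. (M i)\<^sup>\<bottom>)"

abbreviation T :: "'a \<Rightarrow> 'a" where "T \<equiv> proj_product M m"

lemma closed_subspace_inter: "closed_subspace common"
  using closed_subspace unfolding common_def by (intro closed_subspace.intro subspace_Inter closed_INT)
    (auto simp: closed_subspace_def)

sublocale inter: closed_subspace common by (rule closed_subspace_inter)

abbreviation proj_common :: "'a \<Rightarrow> 'a" where "proj_common \<equiv> orth_proj common"

lemma subspace_perp_sum: "subspace perp_sum"
  unfolding perp_sum_def by (intro subspace_set_sum subspace_orthogonal_comp)

lemma orthogonal_comp_subset_perp_sum: "i \<in> {1..m} \<Longrightarrow> (M i)\<^sup>\<bottom> \<subseteq> perp_sum"
proof
  fix x assume "i \<in> {1..m}" and "x \<in> (M i)\<^sup>\<bottom>"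
  then show "x \<in> perp_sum"
    by (auto simp: perp_sum_def set_sum_alt subspace_0 subspace_orthogonal_comp intro!: exI[of _ "\<lambda>j. if j = i then x else 0"])
qed

lemma perp_sum_subset_orthogonal_comp: "perp_sum \<subseteq> common\<^sup>\<bottom>"
proof
  fix x assume "x \<in> perp_sum"
  then obtain s where "x = sum s {1..m}" "\<And>i. i \<in> {1..m} \<Longrightarrow> s i \<in> (M i)\<^sup>\<bottom>"
    by (auto simp: perp_sum_def set_sum_alt)
  moreover have "(M i)\<^sup>\<bottom> \<subseteq> common\<^sup>\<bottom>" if "i \<in> {1..m}" for i
    using that by (intro orthogonal_comp_anti_mono) (auto simp: common_def)
  ultimately show "x \<in> common\<^sup>\<bottom>" by (simp only:) (intro subspace_sum subspace_orthogonal_comp; blast)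
qed

lemma linear_proj_product: "n \<le> m \<Longrightarrow> linear (proj_product M n)"
proof (induction n)
  case (Suc n)
  then show ?case
    using closed_subspace.linear_orth_proj[OF closed_subspace] by (simp add: linear_compose del: o_apply)
qed (simp add: linear_ident id_def)

lemma proj_product_of_mem: "n \<le> m \<Longrightarrow> x \<in> common \<Longrightarrow> proj_product M n x = x"
proof (induction n)
  case (Suc n)
  then show ?case
    using closed_subspace.orth_proj_of_mem[OF closed_subspace, of "Suc n" x] by (simp add: common_def)
qed simp

lemma norm_proj_product_antimono:
  "\<lbrakk>k \<le> n; n \<le> m\<rbrakk> \<Longrightarrow> norm (proj_product M n x) \<le> norm (proj_product M k x)"
proof (induction n rule: dec_induct)
  case (step n)
  then show ?case
    using closed_subspace.norm_orth_proj_le[OF closed_subspace, of "Suc n" "proj_product M n x"] by simp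
qed simp

lemma norm_proj_product_le: "n \<le> m \<Longrightarrow> norm (proj_product M n x) \<le> norm x"
  using norm_proj_product_antimono[of 0 n x] by simp

lemma residual_proj_product_mem_perp_sum: "n \<le> m \<Longrightarrow> x - proj_product M n x \<in> perp_sum"
proof (induction n)
  case 0
  then show ?case using subspace_0[OF subspace_perp_sum] by simp
next
  case (Suc n)
  let ?z = "proj_product M n x"
  have "?z - orth_proj (M (Suc n)) ?z \<in> perp_sum"
    using closed_subspace.orth_proj_residual[OF closed_subspace] orthogonal_comp_subset_perp_sum Suc.prems by fastforce
  with Suc have "(x - ?z) + (?z - orth_proj (M (Suc n)) ?z) \<in> perp_sum"
    by (intro subspace_add[OF subspace_perp_sum]) auto
  then show ?case by simp
qed

text \<open>
  Pythagoras at each projection makes the squared norm drop by the squared length of the step. Together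
  with \<open>(a + b)\<^sup>2 \<le> 2 a\<^sup>2 + 2 b\<^sup>2\<close> this bounds the total displacement by the total drop. In particular
  a vector whose norm is preserved is not moved by any of the projections.
\<close>

lemma proj_product_displacement:
  "n \<le> m \<Longrightarrow> (norm (x - proj_product M n x))\<^sup>2 \<le> 2 ^ n * ((norm x)\<^sup>2 - (norm (proj_product M n x))\<^sup>2)"
proof (induction n)
  case (Suc n)
  let ?z = "proj_product M n x" and ?w = "proj_product M (Suc n) x"
  have pyth: "(norm ?z)\<^sup>2 = (norm ?w)\<^sup>2 + (norm (?z - ?w))\<^sup>2"
    using closed_subspace.orth_proj_pythagoras[OF closed_subspace] Suc.prems by simp
  have "norm (x - ?w) \<le> norm (x - ?z) + norm (?z - ?w)"
    using norm_triangle_ineq[of "x - ?z" "?z - ?w"] by simp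
  then have "(norm (x - ?w))\<^sup>2 \<le> (norm (x - ?z) + norm (?z - ?w))\<^sup>2" by (simp add: power_mono)
  also have "\<dots> \<le> 2 * (norm (x - ?z))\<^sup>2 + 2 * (norm (?z - ?w))\<^sup>2"
    using sum_squares_bound[of "norm (x - ?z)" "norm (?z - ?w)"] by (simp add: power2_sum)
  also have "\<dots> \<le> 2 * (2 ^ n * ((norm x)\<^sup>2 - (norm ?z)\<^sup>2)) + 2 * (2 ^ n * (norm (?z - ?w))\<^sup>2)"
  proof (intro add_mono mult_left_mono)
    show "(norm (?z - ?w))\<^sup>2 \<le> 2 ^ n * (norm (?z - ?w))\<^sup>2"
      using mult_right_mono[of 1 "2 ^ n" "(norm (?z - ?w))\<^sup>2"] by simp
  qed (use Suc in auto)
  also have "\<dots> = 2 ^ Suc n * ((norm x)\<^sup>2 - (norm ?w)\<^sup>2)" by (simp only: pyth) (simp add: algebra_simps)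
  finally show ?case .
qed simp

lemma mem_common_if_fixed:
  assumes "T x = x"
  shows "x \<in> common"
proof -
  have fixed: "proj_product M n x = x" if "n \<le> m" for n
  proof -
    have "norm x \<le> norm (proj_product M n x)"
      using norm_proj_product_antimono[OF that order.refl, of x] assms by simp
    then have "norm (proj_product M n x) = norm x"
      using norm_proj_product_le[OF that, of x] by (rule antisym[rotated])
    then show ?thesis using proj_product_displacement[OF that, of x] by simp
  qed
  have "x \<in> M i" if i: "i \<in> {1..m}" for i
  proof -
    obtain n where n: "i = Suc n" "n < m" using i by (cases i) auto
    then have "orth_proj (M i) x = x" using fixed[of n] fixed[of "Suc n"] by simp
    then show ?thesis using closed_subspace.orth_proj_mem[OF closed_subspace[OF i], of x] by simp
  qed
  then show ?thesis by (auto simp: common_def)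
qed

text \<open>
  A converse estimate: a point close to all the subspaces is moved little, so its squared norm drops
  little. The two bounds are proved together because the \<open>(n + 1)\<close>-st step has length at most \<open>D\<close> plus the
  displacement so far, and the squares of these lengths are the drops. That the drop is quadratic in
  \<open>D\<close> is what makes distances lose only half a power of \<open>k\<close>.
\<close>

lemma proj_product_decrease:
  assumes "\<And>i. i \<in> {1..m} \<Longrightarrow> infdist x (M i) \<le> D" and "D \<ge> 0"
  shows "n \<le> m \<Longrightarrow> norm (x - proj_product M n x) \<le> real n * D \<and>
    (norm x)\<^sup>2 - (norm (proj_product M n x))\<^sup>2 \<le> real n ^ 3 * D\<^sup>2"
proof (induction n)
  case (Suc n)
  interpret P: closed_subspace "M (Suc n)" by (rule closed_subspace) (use Suc.prems in auto)
  define P where "P = orth_proj (M (Suc n))"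
  define z where "z = proj_product M n x"
  have IH: "norm (x - z) \<le> real n * D" "(norm x)\<^sup>2 - (norm z)\<^sup>2 \<le> real n ^ 3 * D\<^sup>2"
    using Suc by (auto simp: z_def)
  have D: "norm (x - P x) \<le> D"
    using assms(1)[of "Suc n"] Suc.prems by (simp add: P.infdist_eq_norm_residual P_def)
  have lin: "P (x - z) = P x - P z" by (simp add: P_def linear_diff[OF P.linear_orth_proj])
  have "norm (x - P z) = norm ((x - P x) + P (x - z))" by (simp add: lin)
  also have "\<dots> \<le> norm (x - P x) + norm (P (x - z))" by (rule norm_triangle_ineq)
  also have "\<dots> \<le> D + real n * D"
    using D IH(1) P.norm_orth_proj_le[of "x - z"] by (simp add: P_def)
  finally have 1: "norm (x - P z) \<le> real (Suc n) * D" by (simp add: algebra_simps)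
  have "norm (z - P z) = norm ((x - P x) - ((x - z) - P (x - z)))" by (simp add: lin)
  also have "\<dots> \<le> norm (x - P x) + norm ((x - z) - P (x - z))" by (rule norm_triangle_ineq4)
  also have "\<dots> \<le> D + real n * D"
    using D IH(1) P.norm_residual_le[of "x - z"] by (simp add: P_def)
  finally have "(norm (z - P z))\<^sup>2 \<le> (real (Suc n) * D)\<^sup>2"
    by (intro power_mono) (auto simp: algebra_simps)
  moreover have "(norm z)\<^sup>2 = (norm (P z))\<^sup>2 + (norm (z - P z))\<^sup>2"
    unfolding P_def by (rule P.orth_proj_pythagoras)
  ultimately have "(norm x)\<^sup>2 - (norm (P z))\<^sup>2 \<le> real n ^ 3 * D\<^sup>2 + (real (Suc n) * D)\<^sup>2"
    using IH(2) by linarith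
  also have "\<dots> = (real n ^ 3 + (real (Suc n))\<^sup>2) * D\<^sup>2" by (simp only: power_mult_distrib distrib_right)
  also have "\<dots> \<le> real (Suc n) ^ 3 * D\<^sup>2"
    by (intro mult_right_mono) (auto simp: power2_eq_square power3_eq_cube algebra_simps)
  finally show ?case using 1 by (simp add: P_def z_def)
qed simp

section \<open>Convergence of the iterates\<close>

lemma linear_iterate: "linear (T ^^ k)"
proof (induction k)
  case (Suc k)
  then show ?case using linear_proj_product[OF order.refl] by (simp add: linear_compose del: o_apply)
qed (simp add: linear_ident id_def)

lemma norm_iterate_le: "norm ((T ^^ k) x) \<le> norm x"
proof (induction k)
  case (Suc k)
  then show ?case using norm_proj_product_le[OF order.refl, of "(T ^^ k) x"] by simp
qed simp

lemma iterate_of_mem: "x \<in> common \<Longrightarrow> (T ^^ k) x = x"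
  by (induction k) (simp_all add: proj_product_of_mem[OF order.refl])

lemma residual_iterate_mem_perp_sum: "x - (T ^^ k) x \<in> perp_sum"
proof (induction k)
  case 0
  then show ?case using subspace_0[OF subspace_perp_sum] by simp
next
  case (Suc k)
  have "(x - (T ^^ k) x) + ((T ^^ k) x - T ((T ^^ k) x)) \<in> perp_sum"
    by (intro subspace_add[OF subspace_perp_sum] Suc residual_proj_product_mem_perp_sum order.refl)
  then show ?case by simp
qed

lemma orth_proj_iterate: "proj_common ((T ^^ k) x) = proj_common x"
proof -
  have "proj_common (x - (T ^^ k) x) = 0"
    using residual_iterate_mem_perp_sum perp_sum_subset_orthogonal_comp by (intro inter.orth_proj_of_orthogonal) blast
  then show ?thesis by (simp add: linear_diff[OF inter.linear_orth_proj])
qed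

lemma norm_iterate_error: "(norm ((T ^^ k) x - proj_common x))\<^sup>2 = (norm ((T ^^ k) x))\<^sup>2 - (norm (proj_common x))\<^sup>2"
  using inter.orth_proj_pythagoras[of "(T ^^ k) x"] by (simp add: orth_proj_iterate)

text \<open>
  The squared norms decrease to a limit, so their decrements tend to zero, and these dominate the
  squared lengths of the steps up to a constant factor.
\<close>

lemma asymptotic_regularity: "(\<lambda>k. (T ^^ k) x - (T ^^ Suc k) x) \<longlonglongrightarrow> 0"
proof -
  define f where "f k = (norm ((T ^^ k) x))\<^sup>2" for k
  have "decseq f"
    unfolding f_def
    by (intro decseq_SucI power_mono) (simp_all add: norm_proj_product_le)
  then obtain l where "f \<longlonglongrightarrow> l" using decseq_convergent[of f 0] by (auto simp: f_def)
  then have "(\<lambda>k. 2 ^ m * (f k - f (Suc k))) \<longlonglongrightarrow> 2 ^ m * (l - l)"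
    by (intro tendsto_intros LIMSEQ_Suc)
  then have "(\<lambda>k. 2 ^ m * (f k - f (Suc k))) \<longlonglongrightarrow> 0" by simp
  then have "(\<lambda>k. (norm ((T ^^ k) x - (T ^^ Suc k) x))\<^sup>2) \<longlonglongrightarrow> 0"
    by (rule tendsto_sandwich[OF _ _ tendsto_const, rotated 2])
      (auto simp: f_def proj_product_displacement)
  then show ?thesis by (simp add: tendsto_norm_zero_iff)
qed

text \<open>
  The theorem of von Neumann and Halperin. By asymptotic regularity the iterates tend to zero on the
  range of \<open>I - T\<close>, and, being contractions, on its closure \<open>R\<close>. A vector orthogonal to that range is
  fixed by \<open>T\<close>, because \<open>T\<close> does not increase norms, and hence lies in all the subspaces. So \<open>R\<close> is
  the whole orthogonal complement of their intersection.
\<close>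

theorem iterate_tendsto: "(\<lambda>k. (T ^^ k) x) \<longlonglongrightarrow> proj_common x"
proof -
  define R where "R = closure (range (\<lambda>w. w - T w))"
  define Z where "Z = {z. (\<lambda>k. (T ^^ k) z) \<longlonglongrightarrow> 0}"
  have linT: "linear T" using linear_proj_product[OF order.refl] .
  have "linear (\<lambda>w. w - T w)" by (intro linear_compose_sub linear_ident linT)
  then have "subspace (range (\<lambda>w. w - T w))" using linear_subspace_image subspace_UNIV by blast
  then interpret R: closed_subspace R
    by unfold_locales (auto simp: R_def intro: subspace_closure)
  have "w - T w \<in> common\<^sup>\<bottom>" for w
    using residual_proj_product_mem_perp_sum[of m w] perp_sum_subset_orthogonal_comp by blast
  then have R_orth: "R \<subseteq> common\<^sup>\<bottom>"
    unfolding R_def by (intro closure_minimal closed_orthogonal_comp) auto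
  have R_perp: "v \<in> common" if v: "v \<in> R\<^sup>\<bottom>" for v
  proof -
    have "v - T v \<in> R" unfolding R_def by (meson closure_subset rangeI subsetD)
    then have "inner (v - T v) v = 0" using v by (rule orthogonal_comp_inner)
    then have "(norm (v - T v))\<^sup>2 = (norm (T v))\<^sup>2 - (norm v)\<^sup>2"
      by (simp add: power2_norm_eq_inner inner_diff_left inner_diff_right inner_commute)
    also have "\<dots> \<le> 0" using norm_proj_product_le[of m v] by (simp add: power_mono)
    finally have "T v = v" by simp
    then show ?thesis by (rule mem_common_if_fixed)
  qed
  have "closed Z"
  proof -
    have "z \<in> Z" if z: "z \<in> closure Z" for z
      unfolding Z_def mem_Collect_eq
    proof (rule tendstoI)
      fix e :: real assume "e > 0"
      then obtain z' where z': "z' \<in> Z" "dist z' z < e / 2"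
        using z half_gt_zero[OF \<open>e > 0\<close>] unfolding closure_approachable by blast
      have "\<forall>\<^sub>F k in sequentially. dist ((T ^^ k) z') 0 < e / 2"
        using z'(1) unfolding Z_def mem_Collect_eq by (rule tendstoD) (use \<open>e > 0\<close> in simp)
      then show "\<forall>\<^sub>F k in sequentially. dist ((T ^^ k) z) 0 < e"
      proof eventually_elim
        case (elim k)
        have "norm ((T ^^ k) (z - z')) < e / 2"
          using norm_iterate_le[of k "z - z'"] z'(2) by (simp add: dist_norm norm_minus_commute)
        then show ?case
          using elim norm_triangle_ineq[of "(T ^^ k) z'" "(T ^^ k) (z - z')"]
          by (simp add: linear_diff[OF linear_iterate])
      qed
    qed
    then show ?thesis using closure_subset_eq by blast
  qed
  moreover have "w - T w \<in> Z" for w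
    using asymptotic_regularity[of w]
    by (simp add: Z_def linear_diff[OF linear_iterate] funpow_swap1)
  ultimately have "R \<subseteq> Z" unfolding R_def by (intro closure_minimal) auto
  define v where "v = x - proj_common x"
  have "v - orth_proj R v \<in> common\<^sup>\<bottom>"
    by (rule subspace_diff[OF subspace_orthogonal_comp])
      (simp add: v_def inter.orth_proj_residual, rule subsetD[OF R_orth R.orth_proj_mem])
  moreover have "v - orth_proj R v \<in> common" by (intro R_perp R.orth_proj_residual)
  ultimately have "v - orth_proj R v = 0"
    using orthogonal_comp_inner by (metis inner_eq_zero_iff)
  then have "v \<in> Z" using R.orth_proj_mem[of v] \<open>R \<subseteq> Z\<close> by auto
  then have "(\<lambda>k. (T ^^ k) v + proj_common x) \<longlonglongrightarrow> 0 + proj_common x" unfolding Z_def by (intro tendsto_intros) simp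
  then show ?thesis
    by (simp add: v_def linear_diff[OF linear_iterate] iterate_of_mem[OF inter.orth_proj_mem])
qed

section \<open>Rates for increments and distances\<close>

lemma error_rate_of_increment_rate:
  assumes "s > 0" "C \<ge> 0"
    and "\<And>k. k \<ge> 1 \<Longrightarrow> norm ((T ^^ Suc k) x - (T ^^ k) x) \<le> C * real k powr - (1 + s)"
    and "k \<ge> 1"
  shows "norm ((T ^^ k) x - proj_common x) \<le> 2 powr (1 + s) / s * C * real k powr - s"
proof (rule null_sequence_powr_rate)
  show "(\<lambda>k. norm ((T ^^ k) x - proj_common x)) \<longlonglongrightarrow> 0"
    using iterate_tendsto[of x] by (simp only: tendsto_norm_zero_iff LIM_zero_iff)
  fix k :: nat assume "k \<ge> 1"
  have "norm ((T ^^ k) x - proj_common x) - norm ((T ^^ Suc k) x - proj_common x) \<le> norm ((T ^^ Suc k) x - (T ^^ k) x)"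
    using norm_triangle_ineq2[of "(T ^^ k) x - proj_common x" "(T ^^ Suc k) x - proj_common x"]
    by (simp add: norm_minus_commute)
  then show "norm ((T ^^ k) x - proj_common x) - norm ((T ^^ Suc k) x - proj_common x) \<le> C * real k powr - (1 + s)"
    using assms(3)[OF \<open>k \<ge> 1\<close>] by linarith
qed (use assms in auto)

text \<open>
  The squared error differs from \<open>\<parallel>T\<^sup>k x\<parallel>\<^sup>2\<close> by a constant, so its decrements are of order
  \<open>k powr -(1 + 2 * s)\<close>. Summation makes the squared error of order \<open>k powr -(2 * s)\<close>.
\<close>

lemma error_rate_of_distance_rate:
  assumes "s > 0" "C \<ge> 0"
    and dist: "\<And>k i. \<lbrakk>k \<ge> 1; i \<in> {1..m}\<rbrakk> \<Longrightarrow> infdist ((T ^^ k) x) (M i) \<le> C * real k powr - (1/2 + s)"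
    and "k \<ge> 1"
  shows "norm ((T ^^ k) x - proj_common x) \<le> sqrt (2 powr (1 + 2 * s) / (2 * s) * real m ^ 3) * C * real k powr - s"
proof -
  define K where "K = 2 powr (1 + 2 * s) / (2 * s) * real m ^ 3"
  have "K \<ge> 0" using \<open>s > 0\<close> by (simp add: K_def)
  have "(norm ((T ^^ k) x - proj_common x))\<^sup>2 \<le> 2 powr (1 + 2 * s) / (2 * s) * (real m ^ 3 * C\<^sup>2) * real k powr - (2 * s)"
  proof (rule null_sequence_powr_rate)
    have "(\<lambda>k. norm ((T ^^ k) x - proj_common x)) \<longlonglongrightarrow> 0"
      using iterate_tendsto[of x] by (simp only: tendsto_norm_zero_iff LIM_zero_iff)
    then have "(\<lambda>k. (norm ((T ^^ k) x - proj_common x))\<^sup>2) \<longlonglongrightarrow> 0\<^sup>2" by (rule tendsto_power)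
    then show "(\<lambda>k. (norm ((T ^^ k) x - proj_common x))\<^sup>2) \<longlonglongrightarrow> 0" by simp
    fix k :: nat assume k: "k \<ge> 1"
    have "(norm ((T ^^ k) x))\<^sup>2 - (norm ((T ^^ Suc k) x))\<^sup>2 \<le> real m ^ 3 * (C * real k powr - (1/2 + s))\<^sup>2"
      using proj_product_decrease[of "(T ^^ k) x" "C * real k powr - (1/2 + s)", OF dist[OF k]] \<open>C \<ge> 0\<close>
      by simp
    also have "(C * real k powr - (1/2 + s))\<^sup>2 = C\<^sup>2 * real k powr - (1 + 2 * s)"
      by (simp add: power_mult_distrib power2_eq_square flip: powr_add)
    finally show "(norm ((T ^^ k) x - proj_common x))\<^sup>2 - (norm ((T ^^ Suc k) x - proj_common x))\<^sup>2
        \<le> real m ^ 3 * C\<^sup>2 * real k powr - (1 + 2 * s)"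
      unfolding norm_iterate_error by (simp add: mult.assoc)
  qed (use assms in auto)
  also have "\<dots> = (sqrt K * C * real k powr - s)\<^sup>2"
    using \<open>K \<ge> 0\<close> by (simp add: power_mult_distrib K_def power2_eq_square[of "_ powr _"] flip: powr_add)
  finally show ?thesis
    unfolding K_def[symmetric] by (rule power2_le_imp_le) (use \<open>K \<ge> 0\<close> \<open>C \<ge> 0\<close> in simp)
qed

lemma infdist_le_rms_dist:
  assumes "i \<in> {1..m}"
  shows "infdist x (M i) \<le> sqrt (real m) * rms_dist M m x"
proof -
  have "(infdist x (M i))\<^sup>2 \<le> (\<Sum>j=1..m. (infdist x (M j))\<^sup>2)"
    using assms by (intro member_le_sum) auto
  then have "sqrt ((infdist x (M i))\<^sup>2) \<le> sqrt (\<Sum>i=1..m. (infdist x (M i))\<^sup>2)"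
    by (rule real_sqrt_le_mono)
  also have "\<dots> = sqrt (real m) * rms_dist M m x"
    using assms by (simp add: rms_dist_def flip: real_sqrt_mult)
  finally show ?thesis by (simp add: infdist_nonneg)
qed

text \<open>
  If one of the upper limits were finite, the corresponding quantity would have a polynomial rate, and
  then so would the error, with an exponent greater than \<open>a\<close>.
\<close>

theorem limsup_infinite_of_slow_error:
  assumes slow: "slower_than a (\<lambda>k. norm ((T ^^ k) x - proj_common x))" and "a \<ge> 0" "\<epsilon> > 0"
  shows "limsup (\<lambda>k. ereal (real k powr (a + \<epsilon>) * norm (proj_iter M m x k - proj_common x))) = \<infinity>" (is ?error)
    and "limsup (\<lambda>k. ereal (real k powr (1 + a + \<epsilon>) * norm (proj_iter M m x k - proj_iter M m x (k - 1)))) = \<infinity>" (is ?incr)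
    and "limsup (\<lambda>k. ereal (real k powr (1/2 + a + \<epsilon>) * rms_dist M m (proj_iter M m x k))) = \<infinity>" (is ?rms)
proof -
  define s where "s = a + \<epsilon>"
  have "s > 0" using assms by (simp add: s_def)
  have *: False if "\<And>k. k \<ge> 1 \<Longrightarrow> norm ((T ^^ k) x - proj_common x) \<le> C * real k powr - s" for C
    using slow that \<open>\<epsilon> > 0\<close> by (auto simp: slower_than_def s_def not_le[symmetric])
  show ?error
  proof (rule ccontr)
    assume "\<not> ?error"
    then show False using powr_bound_if_limsup_finite * by (fastforce simp: proj_iter_def s_def)
  qed
  show ?incr
  proof (rule ccontr)
    assume "\<not> ?incr"
    then obtain C where C: "C \<ge> 0" "\<And>k. k \<ge> 1 \<Longrightarrow>
        norm ((T ^^ k) x - (T ^^ (k - 1)) x) \<le> C * real k powr - (1 + a + \<epsilon>)"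
      using powr_bound_if_limsup_finite[of "1 + a + \<epsilon>" "\<lambda>k. norm (proj_iter M m x k - proj_iter M m x (k - 1))"]
      by (auto simp: proj_iter_def)
    have "norm ((T ^^ Suc k) x - (T ^^ k) x) \<le> C * real k powr - (1 + s)" if "k \<ge> 1" for k
    proof -
      have "norm ((T ^^ Suc k) x - (T ^^ k) x) \<le> C * real (Suc k) powr - (1 + s)"
        using C(2)[of "Suc k"] by (simp add: s_def add.assoc)
      also have "\<dots> \<le> C * real k powr - (1 + s)"
        using C(1) that \<open>s > 0\<close> by (intro mult_left_mono powr_mono2') auto
      finally show ?thesis .
    qed
    from error_rate_of_increment_rate[OF \<open>s > 0\<close> C(1) this] show False by (rule *)
  qed
  show ?rms
  proof (rule ccontr)
    assume "\<not> ?rms"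
    then obtain C where C: "C \<ge> 0" "\<And>k. k \<ge> 1 \<Longrightarrow>
        rms_dist M m ((T ^^ k) x) \<le> C * real k powr - (1/2 + a + \<epsilon>)"
      using powr_bound_if_limsup_finite[of "1/2 + a + \<epsilon>" "\<lambda>k. rms_dist M m (proj_iter M m x k)"]
      by (auto simp: proj_iter_def)
    have "infdist ((T ^^ k) x) (M i) \<le> (sqrt (real m) * C) * real k powr - (1/2 + s)"
      if "k \<ge> 1" "i \<in> {1..m}" for k i
    proof -
      have "infdist ((T ^^ k) x) (M i) \<le> sqrt (real m) * rms_dist M m ((T ^^ k) x)"
        by (rule infdist_le_rms_dist) fact
      also have "\<dots> \<le> sqrt (real m) * (C * real k powr - (1/2 + s))"
        using C(2)[OF that(1)] by (intro mult_left_mono) (auto simp: s_def add.assoc)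
      finally show ?thesis by (simp add: mult.assoc)
    qed
    with error_rate_of_distance_rate[OF \<open>s > 0\<close>, of "sqrt (real m) * C"] C(1) show False
      by (intro *) auto
  qed
qed

section \<open>Uniform rates force the sum of the complements to be closed\<close>

lemma linear_error: "linear (\<lambda>x. (T ^^ k) x - proj_common x)"
  by (intro linear_compose_sub linear_iterate inter.linear_orth_proj)

text \<open>
  For \<open>z\<close> orthogonal to the intersection, the map \<open>w \<mapsto> z + T\<^sup>k w - P w\<close> is a contraction. Its fixed
  point satisfies \<open>z = w - T\<^sup>k w + P w\<close>; applying \<open>P\<close> gives \<open>P w = 0\<close>, and \<open>w - T\<^sup>k w\<close> is in the sum of
  the complements. So this sum is the full orthogonal complement of the intersection.
\<close>

lemma closed_perp_sum_if_contraction: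
  assumes "q < 1" and contr: "\<And>x. norm ((T ^^ k) x - proj_common x) \<le> q * norm x"
  shows "closed perp_sum"
proof -
  have "z \<in> perp_sum" if z: "z \<in> common\<^sup>\<bottom>" for z
  proof -
    define f where "f w = z + ((T ^^ k) w - proj_common w)" for w
    have "dist (f v) (f w) \<le> max q 0 * dist v w" for v w
    proof -
      have "dist (f v) (f w) = norm ((T ^^ k) (v - w) - proj_common (v - w))"
        using linear_diff[OF linear_error, of k v w] by (simp add: f_def dist_norm)
      also have "\<dots> \<le> q * norm (v - w)" by (rule contr)
      also have "\<dots> \<le> max q 0 * norm (v - w)" by (intro mult_right_mono) auto
      finally show ?thesis by (simp add: dist_norm)
    qed
    then obtain w where "f w = w"
      using banach_fix_type[of "max q 0" f] \<open>q < 1\<close> by (metis less_max_iff_disj max_def max.cobounded2 zero_less_one)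
    then have w: "z = (w - (T ^^ k) w) + proj_common w" by (simp add: f_def algebra_simps)
    have "proj_common z = proj_common w"
      by (subst w) (simp add: linear_add[OF inter.linear_orth_proj] linear_diff[OF inter.linear_orth_proj]
          orth_proj_iterate inter.orth_proj_of_mem inter.orth_proj_mem)
    then have "proj_common w = 0" using z by (simp add: inter.orth_proj_of_orthogonal)
    then show "z \<in> perp_sum" using w residual_iterate_mem_perp_sum[of w k] by simp
  qed
  then have "perp_sum = common\<^sup>\<bottom>" using perp_sum_subset_orthogonal_comp by blast
  then show ?thesis by (simp add: closed_orthogonal_comp)
qed

lemma closed_perp_sum_if_uniform_rate:
  assumes "s > 0" and rate: "\<And>k x. k \<ge> 1 \<Longrightarrow> norm ((T ^^ k) x - proj_common x) \<le> C * real k powr - s * norm x"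
  shows "closed perp_sum"
proof -
  have "(\<lambda>k. C * real k powr - s) \<longlonglongrightarrow> C * 0"
    using \<open>s > 0\<close> by (intro tendsto_intros tendsto_neg_powr filterlim_real_sequentially) auto
  then have "\<forall>\<^sub>F k in sequentially. C * real k powr - s < 1/2 \<and> k \<ge> 1"
    by (intro eventually_conj order_tendstoD(2) eventually_ge_at_top) auto
  then obtain k where k: "C * real k powr - s < 1/2" "k \<ge> 1"
    using eventually_happens trivial_limit_sequentially by blast
  show ?thesis
    by (rule closed_perp_sum_if_contraction[of "C * real k powr - s" k]) (use k rate in auto)
qed

text \<open>
  Let \<open>z\<close> be the \<open>k\<close>-th iterate of \<open>x\<close> under the adjoint of \<open>T\<close> and \<open>d\<close> the component of \<open>z\<close> orthogonal
  to \<open>M i\<close>. Then \<open>\<parallel>d\<parallel>\<^sup>2 = \<langle>d, z\<rangle> = \<langle>T\<^sup>k d, x\<rangle>\<close>, and the assumed rate for \<open>T\<^sup>k\<close> on the complement of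
  \<open>M i\<close> bounds \<open>\<parallel>d\<parallel>\<close>, which is the distance of \<open>z\<close> from \<open>M i\<close>. The adjoint is a product of the same
  projections, so distance rates give it a uniform error rate. The reversed family has the same sum
  of complements.
\<close>

lemma closed_perp_sum_if_rate_on_complements:
  assumes "s > 0"
    and rate: "\<And>k i w. \<lbrakk>k \<ge> 1; i \<in> {1..m}; w \<in> (M i)\<^sup>\<bottom>\<rbrakk> \<Longrightarrow>
      norm ((T ^^ k) w) \<le> C i * real k powr - (1/2 + s) * norm w"
  shows "closed perp_sum"
proof -
  define R where "R i = M (Suc m - i)" for i
  have R_eq: "(\<lambda>i. M (Suc m - i)) = R" by (simp add: R_def fun_eq_iff)
  interpret R: closed_subspace_family R m
    by (rule closed_subspace_family.intro) (auto simp: R_def intro!: closed_subspace)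
  define C' where "C' = (\<Sum>i=1..m. \<bar>C i\<bar>)"
  have "C' \<ge> 0" by (simp add: C'_def sum_nonneg)
  have adj: "inner ((T ^^ k) x) y = inner x ((R.T ^^ k) y)" for k x y
  proof (induction k arbitrary: y)
    case (Suc k)
    have "inner ((T ^^ Suc k) x) y = inner ((T ^^ k) x) (R.T y)"
      using inner_proj_product_reverse[of m M "(T ^^ k) x" y] closed_subspace by (simp add: R_eq)
    then show ?case by (simp add: Suc funpow_swap1)
  qed simp
  have dist: "infdist ((R.T ^^ k) x) (M i) \<le> (C' * norm x) * real k powr - (1/2 + s)"
    if k: "k \<ge> 1" and i: "i \<in> {1..m}" for k i x
  proof -
    interpret Mi: closed_subspace "M i" by (rule closed_subspace[OF i])
    define z where "z = (R.T ^^ k) x"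
    define d where "d = z - orth_proj (M i) z"
    have d: "d \<in> (M i)\<^sup>\<bottom>" unfolding d_def by (rule Mi.orth_proj_residual)
    have "inner (orth_proj (M i) z) d = 0" using Mi.orth_proj_mem d by (rule orthogonal_comp_inner)
    then have "(norm d)\<^sup>2 = inner d z"
      by (simp add: d_def power2_norm_eq_inner inner_diff_left inner_diff_right inner_commute)
    also have "\<dots> = inner ((T ^^ k) d) x" by (simp add: adj z_def)
    also have "\<dots> \<le> norm ((T ^^ k) d) * norm x" by (rule norm_cauchy_schwarz)
    also have "\<dots> \<le> (C i * real k powr - (1/2 + s) * norm d) * norm x"
      by (intro mult_right_mono rate k i d) auto
    also have "\<dots> \<le> (C' * real k powr - (1/2 + s) * norm d) * norm x"
    proof (intro mult_right_mono)
      have "\<bar>C i\<bar> \<le> C'" unfolding C'_def using i by (intro member_le_sum) auto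
      then show "C i \<le> C'" by linarith
    qed auto
    finally have "norm d * norm d \<le> norm d * ((C' * norm x) * real k powr - (1/2 + s))"
      by (simp add: power2_eq_square mult_ac)
    then have "norm d \<le> (C' * norm x) * real k powr - (1/2 + s)"
      using \<open>C' \<ge> 0\<close> by (cases "d = 0") (simp_all add: mult_le_cancel_left)
    then show ?thesis by (simp add: Mi.infdist_eq_norm_residual d_def z_def)
  qed
  define K where "K = sqrt (2 powr (1 + 2 * s) / (2 * s) * real m ^ 3)"
  have "norm ((R.T ^^ k) x - R.proj_common x) \<le> (K * C') * real k powr - s * norm x" if "k \<ge> 1" for k x
  proof -
    have "infdist ((R.T ^^ k) x) (R i) \<le> (C' * norm x) * real k powr - (1/2 + s)"
      if "k \<ge> 1" "i \<in> {1..m}" for k i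
    proof -
      have "Suc m - i \<in> {1..m}" using that by auto
      from dist[OF \<open>k \<ge> 1\<close> this, of x] show ?thesis by (simp add: R_def)
    qed
    then have "norm ((R.T ^^ k) x - R.proj_common x) \<le> K * (C' * norm x) * real k powr - s"
      unfolding K_def using \<open>C' \<ge> 0\<close> \<open>k \<ge> 1\<close> \<open>s > 0\<close>
      by (intro R.error_rate_of_distance_rate) auto
    then show ?thesis by (simp add: mult_ac)
  qed
  then have "closed R.perp_sum" by (rule R.closed_perp_sum_if_uniform_rate[OF \<open>s > 0\<close>])
  moreover have "R.perp_sum = perp_sum"
    unfolding R.perp_sum_def perp_sum_def
    by (rule sum.reindex_bij_witness[of _ "\<lambda>i. Suc m - i" "\<lambda>i. Suc m - i"]) (auto simp: R_def)
  ultimately show ?thesis by simp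
qed

section \<open>Dense sets of slowly converging starting points\<close>

lemma continuous_on_error: "continuous_on S (\<lambda>x. (T ^^ k) x - proj_common x)"
  by (intro continuous_on_diff continuous_on_nonexpansive_linear linear_iterate inter.linear_orth_proj
      norm_iterate_le inter.norm_orth_proj_le)

text \<open>
  A bound on a ball around \<open>e\<close> gives, by subtracting the value at \<open>e\<close> and scaling, a bound in operator
  norm with the same rate.
\<close>

theorem dense_slow_error:
  assumes "\<not> closed perp_sum"
  shows "closure {x. slower_than 0 (\<lambda>k. norm ((T ^^ k) x - proj_common x))} = UNIV"
proof (rule closure_slower_than_eq_UNIV[OF continuous_on_error], rule ccontr)
  fix S :: "'a set" and \<epsilon> C :: real
  assume S: "open S" "S \<noteq> {}" and "\<epsilon> > 0"
  assume neg: "\<not> (\<exists>e\<in>S. \<exists>k\<ge>1. C * real k powr - (0 + \<epsilon>) < norm ((T ^^ k) e - proj_common e))"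
  then have bound: "norm ((T ^^ k) e - proj_common e) \<le> C * real k powr - \<epsilon>" if "e \<in> S" "k \<ge> 1" for e k
    using neg that by (metis add_0 not_less)
  obtain e \<delta> where e: "e \<in> S" "\<delta> > 0" "ball e \<delta> \<subseteq> S"
    using S by (meson all_not_in_conv openE)
  have "norm ((T ^^ k) t - proj_common t) \<le> (4 * C / \<delta>) * real k powr - \<epsilon> * norm t" if k: "k \<ge> 1" for k t
  proof -
    have "norm ((T ^^ k) t - proj_common t) \<le> 2 * (2 * (C * real k powr - \<epsilon>)) / \<delta> * norm t"
    proof (rule linear_bound_of_local_bound[OF linear_error subspace_UNIV \<open>\<delta> > 0\<close>])
      fix t :: 'a assume "norm t < \<delta>"
      then have "e + t \<in> S" using e by (auto simp: dist_norm)
      have "(T ^^ k) t - proj_common t = ((T ^^ k) (e + t) - proj_common (e + t)) - ((T ^^ k) e - proj_common e)"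
        using linear_add[OF linear_error[of k], of e t] by simp
      then show "norm ((T ^^ k) t - proj_common t) \<le> 2 * (C * real k powr - \<epsilon>)"
        using norm_triangle_ineq4[of "(T ^^ k) (e + t) - proj_common (e + t)" "(T ^^ k) e - proj_common e"]
          bound[OF \<open>e + t \<in> S\<close> k] bound[OF e(1) k] by simp
    qed simp
    then show ?thesis by simp
  qed
  then have "closed perp_sum" by (rule closed_perp_sum_if_uniform_rate[OF \<open>\<epsilon> > 0\<close>])
  with assms show False ..
qed

text \<open>
  Maps the complete metric space of all sequences, with its product topology, onto the sum of the
  intersection and the complements. Projecting the entries avoids restricting the domain to families
  with entries in the right subspaces.
\<close>
definition synth :: "(nat \<Rightarrow> 'a) \<Rightarrow> 'a" where
  "synth e = proj_common (e 0) + (\<Sum>i=1..m. e i - orth_proj (M i) (e i))"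

lemma synth_mem: "synth e \<in> common + perp_sum"
  unfolding synth_def
proof (rule set_plus_intro)
  show "(\<Sum>i=1..m. e i - orth_proj (M i) (e i)) \<in> perp_sum"
    using orthogonal_comp_subset_perp_sum closed_subspace.orth_proj_residual[OF closed_subspace]
    by (intro subspace_sum[OF subspace_perp_sum]) blast
qed (rule inter.orth_proj_mem)

lemma subset_range_synth: "common + perp_sum \<subseteq> range synth"
proof
  fix y assume "y \<in> common + perp_sum"
  then obtain a b where ab: "y = a + b" "a \<in> common" "b \<in> perp_sum" by (rule set_plus_elim)
  from ab(3) obtain s where s: "b = sum s {1..m}" "\<And>i. i \<in> {1..m} \<Longrightarrow> s i \<in> (M i)\<^sup>\<bottom>"
    by (auto simp: perp_sum_def set_sum_alt)
  have "synth (s(0 := a)) = a + (\<Sum>i=1..m. s i)"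
    unfolding synth_def
  proof (intro arg_cong2[where f = "(+)"] sum.cong refl)
    show "proj_common ((s(0 := a)) 0) = a" using ab by (simp add: inter.orth_proj_of_mem)
    show "(s(0 := a)) i - orth_proj (M i) ((s(0 := a)) i) = s i" if "i \<in> {1..m}" for i
      using that closed_subspace.orth_proj_of_orthogonal[OF closed_subspace s(2), OF that that] by auto
  qed
  then show "y \<in> range synth" using ab s by (metis rangeI)
qed

lemma continuous_on_synth: "continuous_on S synth"
proof -
  have coord: "continuous_on UNIV (\<lambda>e. orth_proj L (e i))" if "closed_subspace L" for L :: "'a set" and i :: nat
  proof -
    interpret closed_subspace L by fact
    show ?thesis
      by (intro continuous_on_compose2[OF continuous_on_nonexpansive_linear[of "orth_proj L" UNIV]]
          linear_orth_proj norm_orth_proj_le continuous_on_product_coordinates) auto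
  qed
  have "continuous_on UNIV synth"
    unfolding synth_def[abs_def]
    by (intro continuous_on_add continuous_on_sum continuous_on_diff continuous_on_product_coordinates
        coord closed_subspace inter.closed_subspace_axioms)
  then show ?thesis by (rule continuous_on_subset) simp
qed

text \<open>
  One coordinate of \<open>e\<close> suffices to reach all small perturbations in one complement. Hence an open set
  of families is used only through its sections in single coordinates.
\<close>

lemma synth_perturb:
  assumes i: "i \<in> {1..m}" and t: "t \<in> (M i)\<^sup>\<bottom>"
  shows "synth (e(i := e i + t)) = synth e + t"
proof -
  interpret Mi: closed_subspace "M i" by (rule closed_subspace[OF i])
  have "(\<Sum>j=1..m. (e(i := e i + t)) j - orth_proj (M j) ((e(i := e i + t)) j))
      = (\<Sum>j=1..m. (e j - orth_proj (M j) (e j)) + (if j = i then t else 0))"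
    using t by (intro sum.cong) (auto simp: linear_add[OF Mi.linear_orth_proj] Mi.orth_proj_of_orthogonal)
  also have "\<dots> = (\<Sum>j=1..m. e j - orth_proj (M j) (e j)) + t"
    using i by (simp add: sum.distrib)
  finally show ?thesis using i by (auto simp: synth_def)
qed

text \<open>
  As before, but only the sections of the open set in the coordinates \<open>1, \<dots>, m\<close> matter: they give a
  rate on each of the complements.
\<close>

theorem dense_slow_error_sum:
  assumes "\<not> closed perp_sum"
  shows "closure {e. slower_than (1/2) (\<lambda>k. norm ((T ^^ k) (synth e) - proj_common (synth e)))} = UNIV"
proof (rule closure_slower_than_eq_UNIV)
  show "continuous_on UNIV (\<lambda>e. (T ^^ k) (synth e) - proj_common (synth e))" for k
    by (rule continuous_on_compose2[OF continuous_on_error continuous_on_synth subset_UNIV])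
  fix S :: "(nat \<Rightarrow> 'a) set" and \<epsilon> C :: real
  assume S: "open S" "S \<noteq> {}" and "\<epsilon> > 0"
  let ?D = "\<lambda>k e. (T ^^ k) (synth e) - proj_common (synth e)"
  show "\<exists>e\<in>S. \<exists>k\<ge>1. C * real k powr - (1/2 + \<epsilon>) < norm (?D k e)"
  proof (rule ccontr)
    assume "\<not> ?thesis"
    then have bound: "norm (?D k e) \<le> C * real k powr - (1/2 + \<epsilon>)" if "e \<in> S" "k \<ge> 1" for e k
      using that by (meson not_less)
    obtain e where e: "e \<in> S" using S by blast
    have "\<exists>\<delta>>0. \<forall>t. norm t < \<delta> \<longrightarrow> e(i := e i + t) \<in> S" for i
    proof -
      have "continuous_on UNIV (\<lambda>t. (e(i := e i + t)) j)" for j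
        by (cases "j = i") (auto intro!: continuous_intros)
      then have "continuous_on UNIV (\<lambda>t. e(i := e i + t))"
        by (rule continuous_on_coordinatewise_then_product)
      then have "open ((\<lambda>t. e(i := e i + t)) -` S)" by (intro open_vimage S)
      moreover have "0 \<in> (\<lambda>t. e(i := e i + t)) -` S" using e by simp
      ultimately obtain \<delta> where "\<delta> > 0" "ball 0 \<delta> \<subseteq> (\<lambda>t. e(i := e i + t)) -` S" by (rule openE)
      then show ?thesis by (intro exI[of _ \<delta>]) (auto simp: subset_iff)
    qed
    then obtain \<delta> where \<delta>: "\<And>i. \<delta> i > 0" "\<And>i t. norm t < \<delta> i \<Longrightarrow> e(i := e i + t) \<in> S" by metis
    have "norm ((T ^^ k) w) \<le> (4 * C / \<delta> i) * real k powr - (1/2 + \<epsilon>) * norm w"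
      if k: "k \<ge> 1" and i: "i \<in> {1..m}" and w: "w \<in> (M i)\<^sup>\<bottom>" for k i w
    proof -
      have "norm ((T ^^ k) w) \<le> 2 * (2 * (C * real k powr - (1/2 + \<epsilon>))) / \<delta> i * norm w"
      proof (rule linear_bound_of_local_bound[OF linear_iterate subspace_orthogonal_comp \<delta>(1) _ w])
        fix t assume t: "t \<in> (M i)\<^sup>\<bottom>" and "norm t < \<delta> i"
        then have et: "e(i := e i + t) \<in> S" by (intro \<delta>(2))
        have "t \<in> common\<^sup>\<bottom>" using t orthogonal_comp_subset_perp_sum[OF i] perp_sum_subset_orthogonal_comp by blast
        then have "?D k (e(i := e i + t)) = ?D k e + (T ^^ k) t"
          by (simp add: synth_perturb[OF i t] linear_add[OF linear_iterate]
              linear_add[OF inter.linear_orth_proj] inter.orth_proj_of_orthogonal)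
        then have "(T ^^ k) t = ?D k (e(i := e i + t)) - ?D k e" by simp
        then show "norm ((T ^^ k) t) \<le> 2 * (C * real k powr - (1/2 + \<epsilon>))"
          using norm_triangle_ineq4[of "?D k (e(i := e i + t))" "?D k e"] bound[OF et k] bound[OF e k]
          by simp
      qed
      then show ?thesis by simp
    qed
    then have "closed perp_sum" by (rule closed_perp_sum_if_rate_on_complements[OF \<open>\<epsilon> > 0\<close>])
    with assms show False ..
  qed
qed

end

theorem theorem4p5:
  fixes M :: "nat \<Rightarrow> 'a::{real_inner, complete_space} set"
    and m :: nat
  assumes "\<And>i. i \<in> {1..m} \<Longrightarrow> subspace (M i)"
    and "\<And>i. i \<in> {1..m} \<Longrightarrow> closed (M i)"
    and "\<not> closed (\<Sum>i\<in>{1..m}. (M i)\<^sup>\<bottom>)"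
  shows
    "(\<exists>U :: 'a set. closure U = UNIV \<and>
        (\<forall>y\<^sub>0\<in>U. \<forall>\<epsilon>>0.
           limsup (\<lambda>k. ereal (real k powr (1 + \<epsilon>)
             * norm (proj_iter M m y\<^sub>0 k - proj_iter M m y\<^sub>0 (k - 1)))) = \<infinity> \<and>
           limsup (\<lambda>k. ereal (real k powr (1/2 + \<epsilon>)
             * rms_dist M m (proj_iter M m y\<^sub>0 k))) = \<infinity>)) \<and>
     (\<exists>V. V \<subseteq> (\<Inter>i\<in>{1..m}. M i) + (\<Sum>i\<in>{1..m}. (M i)\<^sup>\<bottom>) \<and>
        (\<Inter>i\<in>{1..m}. M i) + (\<Sum>i\<in>{1..m}. (M i)\<^sup>\<bottom>) \<subseteq> closure V \<and>
        (\<forall>y\<^sub>0\<in>V. \<forall>\<epsilon>>0.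
           limsup (\<lambda>k. ereal (real k powr (1/2 + \<epsilon>)
             * norm (proj_iter M m y\<^sub>0 k - orth_proj (\<Inter>i\<in>{1..m}. M i) y\<^sub>0))) = \<infinity> \<and>
           limsup (\<lambda>k. ereal (real k powr (3/2 + \<epsilon>)
             * norm (proj_iter M m y\<^sub>0 k - proj_iter M m y\<^sub>0 (k - 1)))) = \<infinity> \<and>
           limsup (\<lambda>k. ereal (real k powr (1 + \<epsilon>)
             * rms_dist M m (proj_iter M m y\<^sub>0 k))) = \<infinity>))"
proof -
  interpret closed_subspace_family M m 
    by (intro closed_subspace_family.intro closed_subspace.intro assms)
  have "\<not> closed perp_sum" unfolding perp_sum_def by (rule assms)
  let ?slow = "\<lambda>a x. slower_than a (\<lambda>k. norm ((T ^^ k) x - proj_common x))"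
  define U where "U = {x. ?slow 0 x}"
  define W where "W = {e. ?slow (1/2) (synth e)}"
  have U: "closure U = UNIV" unfolding U_def by (rule dense_slow_error) fact
  have W: "closure W = UNIV" unfolding W_def by (rule dense_slow_error_sum) fact
  \<comment> \<open>A continuous map carries a dense set to a dense subset of its range.\<close>
  have "synth ` closure W \<subseteq> closure (synth ` W)"
    by (intro image_closure_subset continuous_on_synth closed_closure closure_subset)
  then have V: "synth ` W \<subseteq> common + perp_sum" "common + perp_sum \<subseteq> closure (synth ` W)"
    using synth_mem subset_range_synth unfolding W by blast+
  have "limsup (\<lambda>k. ereal (real k powr (1 + \<epsilon>) * norm (proj_iter M m y k - proj_iter M m y (k - 1)))) = \<infinity> \<and>
      limsup (\<lambda>k. ereal (real k powr (1/2 + \<epsilon>) * rms_dist M m (proj_iter M m y k))) = \<infinity>"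
    if "y \<in> U" "\<epsilon> > 0" for y and \<epsilon> :: real
    using limsup_infinite_of_slow_error(2,3)[of 0 y \<epsilon>] that by (simp add: U_def)
  moreover have "limsup (\<lambda>k. ereal (real k powr (1/2 + \<epsilon>) * norm (proj_iter M m y k - proj_common y))) = \<infinity> \<and>
      limsup (\<lambda>k. ereal (real k powr (3/2 + \<epsilon>) * norm (proj_iter M m y k - proj_iter M m y (k - 1)))) = \<infinity> \<and>
      limsup (\<lambda>k. ereal (real k powr (1 + \<epsilon>) * rms_dist M m (proj_iter M m y k))) = \<infinity>"
    if "y \<in> synth ` W" "\<epsilon> > 0" for y and \<epsilon> :: real
    using limsup_infinite_of_slow_error[of "1/2" y \<epsilon>] that by (auto simp: W_def)
  ultimately show ?thesis
    unfolding common_def[symmetric] perp_sum_def[symmetric] using U V by blast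
qed

end
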